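(* Let $\mathbb{X}$ be a non-empty set of $s$ distinct points in $\mathbb{P}^{n_1}\times\cdots\times\mathbb{P}^{n_k}$ and let $t_i=|\pi_i(\mathbb{X})|$ for $1\le i\le k$. For $i=1,\ldots,k$ define $l_i:=(t_1-1,\ldots,\widehat{t_i-1},\ldots,t_k-1)\in\mathbb{N}^{k-1}$ (the $i$-th entry is omitted), and for $\underline{j}=(j_1,\ldots,j_k)\in\mathbb{N}^k$ let $\underline{j}_i:=(j_1,\ldots,\widehat{j_i},\ldots,j_k)\in\mathbb{N}^{k-1}$. Then the Hilbert function $H_{\mathbb{X}}$ of $\mathbb{X}$ satisfies, for $\underline{j}=(j_1,\ldots,j_k)\in\mathbb{N}^k$: (a) $H_{\mathbb{X}}(\underline{j})=s$ if $(j_1,\ldots,j_k)\ge(t_1-1,t_2-1,\ldots,t_k-1)$; (b) for each $i\in\{1,\ldots,k\}$, $H_{\mathbb{X}}(\underline{j})=H_{\mathbb{X}}(j_1,\ldots,j_{i-1},t_i-1,j_{i+1},\ldots,j_k)$ if $j_i\ge t_i-1$ and $\underline{j}_i\not\ge l_i$.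
   Context: $\mathbf{k}$ is an algebraically closed field of characteristic zero, $\mathbb{N}=\{0,1,2,\ldots\}$, $k\geq 1$. Tuples are partially ordered componentwise: $\underline{a}\ge\underline{b}$ iff $a_h\ge b_h$ for every $h$. The projective spaces are over $\mathbf{k}$, and a point of $\mathbb{P}^{n_1}\times\cdots\times\mathbb{P}^{n_k}$ is written $[a_{1,0}:\cdots:a_{1,n_1}]\times\cdots\times[a_{k,0}:\cdots:a_{k,n_k}]$. The map $\pi_i:\mathbb{P}^{n_1}\times\cdots\times\mathbb{P}^{n_k}\to\mathbb{P}^{n_i}$ is the projection onto the $i$-th factor. Let $R=\mathbf{k}[x_{1,0},\ldots,x_{1,n_1},\ldots,x_{k,0},\ldots,x_{k,n_k}]$ be $\mathbb{N}^k$-graded by $\deg x_{i,j}=e_i$ (the $i$-th standard basis vector of $\mathbb{N}^k$). For a set $\mathbb{X}$ of points, $I_{\mathbb{X}}\subseteq R$ is the ideal of all polynomials vanishing at every point of $\mathbb{X}$ (equivalently, the ideal generated by the $\mathbb{N}^k$-homogeneous polynomials vanishing on $\mathbb{X}$); it is $\mathbb{N}^k$-homogeneous. The Hilbert function of $\mathbb{X}$ is $H_{\mathbb{X}}:\mathbb{N}^k\to\mathbb{N}$, $H_{\mathbb{X}}(\underline{j})=\dim_{\mathbf{k}}(R/I_{\mathbb{X}})_{\underline{j}}=\dim_{\mathbf{k}}R_{\underline{j}}-\dim_{\mathbf{k}}(I_{\mathbb{X}})_{\underline{j}}$. *)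

theory Defs
  imports "HOL-Library.Poly_Mapping" "HOL-Library.FuncSet"
    "HOL-Computational_Algebra.Polynomial"
begin

text \<open>
  A vector of length \<open>n + 1\<close> is a function on \<^typ>\<open>nat\<close> with coordinates \<open>0, \<dots>, n\<close>
  that is zero beyond \<open>n\<close>.
\<close>

definition nonzero_vecs :: "nat \<Rightarrow> (nat \<Rightarrow> 'a::field) set" where
  "nonzero_vecs n = {v. (\<forall>h>n. v h = 0) \<and> (\<exists>h\<le>n. v h \<noteq> 0)}"

definition proportional :: "nat \<Rightarrow> ((nat \<Rightarrow> 'a::field) \<times> (nat \<Rightarrow> 'a)) set" where
  "proportional n = {(v, w). v \<in> nonzero_vecs n \<and> w \<in> nonzero_vecs n \<and>
     (\<exists>c. c \<noteq> 0 \<and> w = (\<lambda>h. c * v h))}"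

lemma equiv_proportional:
  "equiv (nonzero_vecs n) (proportional n :: ((nat \<Rightarrow> 'a::field) \<times> (nat \<Rightarrow> 'a)) set)"
proof (rule equivI)
  show "proportional n \<subseteq> nonzero_vecs n \<times> (nonzero_vecs n :: (nat \<Rightarrow> 'a) set)"
    by (auto simp: proportional_def)
  show "refl_on (nonzero_vecs n) (proportional n :: ((nat \<Rightarrow> 'a) \<times> (nat \<Rightarrow> 'a)) set)"
    by (auto simp: refl_on_def proportional_def intro!: exI[of _ 1])
  show "sym (proportional n :: ((nat \<Rightarrow> 'a) \<times> (nat \<Rightarrow> 'a)) set)"
  proof (rule symI)
    fix v w :: "nat \<Rightarrow> 'a"
    assume "(v, w) \<in> proportional n"
    then obtain c where "v \<in> nonzero_vecs n" "w \<in> nonzero_vecs n" "c \<noteq> 0" "w = (\<lambda>h. c * v h)"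
      by (auto simp: proportional_def)
    moreover from this have "v = (\<lambda>h. inverse c * w h)" by auto
    moreover from \<open>c \<noteq> 0\<close> have "inverse c \<noteq> 0" by simp
    ultimately show "(w, v) \<in> proportional n"
      unfolding proportional_def by blast
  qed
  show "trans (proportional n :: ((nat \<Rightarrow> 'a) \<times> (nat \<Rightarrow> 'a)) set)"
  proof (rule transI)
    fix u v w :: "nat \<Rightarrow> 'a"
    assume "(u, v) \<in> proportional n" "(v, w) \<in> proportional n"
    then obtain c d where "u \<in> nonzero_vecs n" "w \<in> nonzero_vecs n" "c \<noteq> 0" "d \<noteq> 0"
      "v = (\<lambda>h. c * u h)" "w = (\<lambda>h. d * v h)"
      by (auto simp: proportional_def)
    moreover from this have "w = (\<lambda>h. (d * c) * u h)" by (simp add: mult.assoc)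
    moreover from \<open>c \<noteq> 0\<close> \<open>d \<noteq> 0\<close> have "d * c \<noteq> 0" by simp
    ultimately show "(u, w) \<in> proportional n"
      unfolding proportional_def by blast
  qed
qed

definition proj_space :: "nat \<Rightarrow> (nat \<Rightarrow> 'a::field) set set" where
  "proj_space n = nonzero_vecs n // proportional n"

definition multiproj_space :: "nat \<Rightarrow> (nat \<Rightarrow> nat) \<Rightarrow> (nat \<Rightarrow> (nat \<Rightarrow> 'a::field) set) set" where
  "multiproj_space k n = (\<Pi>\<^sub>E i\<in>{1..k}. proj_space (n i))"

definition factor_proj :: "nat \<Rightarrow> (nat \<Rightarrow> (nat \<Rightarrow> 'a::field) set) \<Rightarrow> (nat \<Rightarrow> 'a) set" where
  "factor_proj i P = P i"

text \<open>\<open>a (i, h)\<close> is the homogeneous coordinate \<open>a\<^sub>i\<^sub>,\<^sub>h\<close> of the point \<open>P\<close>.\<close>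

definition represents :: "nat \<Rightarrow> (nat \<times> nat \<Rightarrow> 'a::field) \<Rightarrow> (nat \<Rightarrow> (nat \<Rightarrow> 'a) set) \<Rightarrow> bool" where
  "represents k a P \<longleftrightarrow> (\<forall>i\<in>{1..k}. (\<lambda>h. a (i, h)) \<in> P i)"

text \<open>
  The variable \<open>x\<^sub>i\<^sub>,\<^sub>h\<close> is encoded by the pair \<open>(i, h)\<close>, a monomial by its finitely supported
  exponent function and a polynomial by its finitely supported coefficient function.  The product
  on \<^type>\<open>poly_mapping\<close> is convolution, hence the usual product of polynomials.
\<close>

type_synonym monom = "(nat \<times> nat) \<Rightarrow>\<^sub>0 nat"
type_synonym 'a mpoly = "monom \<Rightarrow>\<^sub>0 'a"

definition poly_ring :: "nat \<Rightarrow> (nat \<Rightarrow> nat) \<Rightarrow> 'a::field mpoly set" where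
  "poly_ring k n = {f. \<forall>m\<in>Poly_Mapping.keys f. Poly_Mapping.keys m \<subseteq> (SIGMA i:{1..k}. {0..n i})}"

definition mpoly_scale :: "'a::field \<Rightarrow> 'a mpoly \<Rightarrow> 'a mpoly" where
  "mpoly_scale c f = Poly_Mapping.single 0 c * f"

lemma vector_space_mpoly_scale: "vector_space (mpoly_scale :: 'a::field \<Rightarrow> 'a mpoly \<Rightarrow> 'a mpoly)"
proof
  show "mpoly_scale a (x + y) = mpoly_scale a x + mpoly_scale a y" for a :: 'a and x y
    by (simp add: mpoly_scale_def distrib_left)
  show "mpoly_scale (a + b) x = mpoly_scale a x + mpoly_scale b x" for a b :: 'a and x
    by (simp add: mpoly_scale_def distrib_right single_add)
  show "mpoly_scale a (mpoly_scale b x) = mpoly_scale (a * b) x" for a b :: 'a and x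
    by (simp add: mpoly_scale_def mult.assoc[symmetric] mult_single)
  show "mpoly_scale (1::'a) x = x" for x
    by (simp add: mpoly_scale_def)
qed

definition mpoly_eval :: "'a::field mpoly \<Rightarrow> (nat \<times> nat \<Rightarrow> 'a) \<Rightarrow> 'a" where
  "mpoly_eval f a = (\<Sum>m\<in>Poly_Mapping.keys f.
     Poly_Mapping.lookup f m * (\<Prod>v\<in>Poly_Mapping.keys m. a v ^ Poly_Mapping.lookup m v))"

definition multidegree :: "(nat \<Rightarrow> nat) \<Rightarrow> monom \<Rightarrow> nat \<Rightarrow> nat" where
  "multidegree n m i = (\<Sum>h\<le>n i. Poly_Mapping.lookup m (i, h))"

definition graded_part ::
  "nat \<Rightarrow> (nat \<Rightarrow> nat) \<Rightarrow> 'a::field mpoly set \<Rightarrow> (nat \<Rightarrow> nat) \<Rightarrow> 'a mpoly set" where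
  "graded_part k n S j =
     {f \<in> S. \<forall>m\<in>Poly_Mapping.keys f. \<forall>i\<in>{1..k}. multidegree n m i = j i}"

text \<open>
  A polynomial that is not multihomogeneous vanishes at a point if its value is zero at every
  choice of homogeneous coordinates of the point; for a multihomogeneous one the choice is
  irrelevant.
\<close>

definition vanishing_ideal ::
  "nat \<Rightarrow> (nat \<Rightarrow> nat) \<Rightarrow> (nat \<Rightarrow> (nat \<Rightarrow> 'a::field) set) set \<Rightarrow> 'a mpoly set" where
  "vanishing_ideal k n X =
     {f \<in> poly_ring k n. \<forall>P\<in>X. \<forall>a. represents k a P \<longrightarrow> mpoly_eval f a = 0}"

text \<open>
  The subtraction does not truncate: the first graded part is finite-dimensional and contains
  the second.  A multidegree is a function of which only the values on \<open>{1..k}\<close> matter.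
\<close>

definition hilbert_function ::
  "nat \<Rightarrow> (nat \<Rightarrow> nat) \<Rightarrow> (nat \<Rightarrow> (nat \<Rightarrow> 'a::field) set) set \<Rightarrow> (nat \<Rightarrow> nat) \<Rightarrow> nat" where
  "hilbert_function k n X j =
     vector_space.dim mpoly_scale (graded_part k n (poly_ring k n :: 'a mpoly set) j) -
     vector_space.dim mpoly_scale (graded_part k n (vanishing_ideal k n X) j)"

text \<open>
  Omitting the entry at position \<open>i\<close> of a tuple means restricting the positions to \<open>{1..k} - {i}\<close>.
\<close>

definition tuple_ge :: "nat set \<Rightarrow> (nat \<Rightarrow> nat) \<Rightarrow> (nat \<Rightarrow> nat) \<Rightarrow> bool" where
  "tuple_ge I a b \<longleftrightarrow> (\<forall>h\<in>I. a h \<ge> b h)"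

end

theory Submission
  imports Defs "HOL-Library.Function_Algebras"
begin

text \<open>
  After choosing homogeneous coordinates for each point, \<open>H\<^sub>X(j)\<close> is the rank of the evaluation
  map \<open>R\<^sub>j \<rightarrow> k\<^sup>X\<close>.  Products of linear forms separate the \<open>t\<^sub>i\<close> points of \<open>\<pi>\<^sub>i(X)\<close> in every
  degree at least \<open>t\<^sub>i - 1\<close>.  Multiplying such separators over all \<open>i\<close> makes evaluation surjective,
  which is (a).  By interpolation on \<open>\<pi>\<^sub>i(X)\<close>, the image of evaluation does not depend on \<open>j\<^sub>i\<close>
  once \<open>j\<^sub>i \<ge> t\<^sub>i - 1\<close>, which is (b).
\<close>

section \<open>Rank and nullity on a finitely generated subspace\<close>

text \<open>Coefficients over the independent set \<open>B \<union> C\<close> are unique. Those of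
  \<open>x\<close> are supported in \<open>B\<close> and also in \<open>C\<close>, hence all
  vanish.\<close>

lemma (in vector_space) span_Int_span_eq_0:
  assumes "independent (B \<union> C)" "B \<inter> C = {}" "x \<in> span B" "x \<in> span C"
  shows "x = 0"
proof -
  have "representation (B \<union> C) x = representation B x"
    "representation (B \<union> C) x = representation C x"
    using assms by (auto intro!: representation_extend)
  moreover have "representation B x b = 0 \<or> representation C x b = 0" for b
    using representation_ne_zero assms(2) by blast
  ultimately have zero: "representation (B \<union> C) x b = 0" for b
    by metis
  have "x \<in> span (B \<union> C)"
    using assms(3) span_mono[of B "B \<union> C"] by auto
  from sum_nonzero_representation_eq[OF assms(1) this] show ?thesis
    by (simp add: zero)
qed

text \<open>Rank-nullity in the subtractive shape of \<open>hilbert_function\<close>. A basis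
  \<open>D\<close> of the kernel extends to a basis \<open>B\<close> of \<open>S\<close>, and
  \<open>f\<close> maps \<open>C = B - D\<close> injectively onto a basis of the image. The finite
  set \<open>A\<close> forces \<open>B\<close> to be finite, so cardinalities may be
  subtracted.\<close>

lemma (in vector_space_pair) dim_diff_dim_kernel:
  assumes lin: "Vector_Spaces.linear s1 s2 f" and S: "vs1.subspace S"
    and fin: "finite A" "S \<subseteq> vs1.span A"
  shows "vs1.dim S - vs1.dim {x \<in> S. f x = 0} = vs2.dim (f ` S)"
proof -
  define K where "K = {x \<in> S. f x = 0}"
  obtain D where D: "D \<subseteq> K" "vs1.independent D" "K \<subseteq> vs1.span D" "card D = vs1.dim K"
    using vs1.basis_exists by blast
  have "D \<subseteq> S" using D by (auto simp: K_def)
  then obtain B where B: "D \<subseteq> B" "B \<subseteq> S" "vs1.independent B" "S \<subseteq> vs1.span B"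
    using vs1.maximal_independent_subset_extend D(2) by blast
  have finB: "finite B"
    using vs1.independent_span_bound[OF fin(1) B(3)] B(2) fin(2) by auto
  define C where "C = B - D"
  have BDC: "B = D \<union> C" "D \<inter> C = {}" using B(1) by (auto simp: C_def)
  have spS: "vs1.span B = S" using B S by (intro vs1.span_subspace)
  have spC: "vs1.span C \<subseteq> S" using spS vs1.span_mono[of C B] BDC by auto
  have inj: "inj_on f (vs1.span C)"
  proof (rule inj_onI)
    fix x y assume xy: "x \<in> vs1.span C" "y \<in> vs1.span C" "f x = f y"
    then have xyC: "x - y \<in> vs1.span C" by (simp add: vs1.span_diff)
    have "f (x - y) = 0" using xy(3) linear_diff[OF lin] by simp
    \<comment> \<open>\<open>D\<close> spans the kernel, so a kernel element of
      \<open>span C\<close> lies in both spans and is 0.\<close>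
    with xyC spC have "x - y \<in> vs1.span D" using D(3) by (auto simp: K_def)
    with xyC have "x - y = 0"
      using vs1.span_Int_span_eq_0[of D C "x - y"] B(3) BDC by auto
    then show "x = y" by simp
  qed
  have ind: "vs2.independent (f ` C)"
    using vs1.independent_mono[OF B(3), of C] inj BDC
    by (intro linear_independent_injective_image[OF lin]) auto
  have "f ` S = vs2.span (f ` B)"
    using linear_span_image[OF lin, of B] spS by simp
  also have "\<dots> = vs2.span (f ` C)"
  proof (rule vs2.span_eq[THEN iffD2], intro conjI)
    have "f x = 0" if "x \<in> D" for x using that D(1) by (auto simp: K_def)
    then show "f ` B \<subseteq> vs2.span (f ` C)"
      unfolding BDC by (auto simp: vs2.span_zero intro: vs2.span_base)
    show "f ` C \<subseteq> vs2.span (f ` B)"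
      unfolding BDC by (auto intro: vs2.span_base)
  qed
  finally have "vs2.dim (f ` S) = card (f ` C)"
    using vs2.dim_span_eq_card_independent[OF ind] by simp
  also have "\<dots> = card C"
    using inj vs1.span_superset by (intro card_image) (rule inj_on_subset)
  also have "\<dots> = card B - card D"
    unfolding C_def using finB B(1) by (simp add: card_Diff_subset finite_subset)
  also have "card B = vs1.dim S"
    using vs1.dim_span_eq_card_independent[OF B(3)] spS by simp
  finally show ?thesis using D(4) by (simp add: K_def)
qed

section \<open>Evaluation of polynomials\<close>

text \<open>Names the inner product of \<open>mpoly_eval\<close>, so that multiplicativity can be
  settled on monomials first.\<close>

definition monom_eval :: "monom \<Rightarrow> (nat \<times> nat \<Rightarrow> 'a::field) \<Rightarrow> 'a" where
  "monom_eval m a = (\<Prod>v\<in>Poly_Mapping.keys m. a v ^ Poly_Mapping.lookup m v)"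

text \<open>Exponents outside the support are 0 and contribute factors 1. This allows two monomials
  to be evaluated over a common set of variables.\<close>

lemma monom_eval_superset:
  assumes "finite A" "Poly_Mapping.keys m \<subseteq> A"
  shows "monom_eval m a = (\<Prod>v\<in>A. a v ^ Poly_Mapping.lookup m v)"
  unfolding monom_eval_def using assms
  by (intro prod.mono_neutral_left) (auto simp: in_keys_iff)

lemma monom_eval_add: "monom_eval (m + m') a = monom_eval m a * monom_eval m' a"
proof -
  let ?A = "Poly_Mapping.keys m \<union> Poly_Mapping.keys m'"
  have "monom_eval (m + m') a = (\<Prod>v\<in>?A. a v ^ Poly_Mapping.lookup (m + m') v)"
    by (rule monom_eval_superset) (use Poly_Mapping.keys_add[of m m'] in auto)
  also have "\<dots> = monom_eval m a * monom_eval m' a"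
    by (simp add: lookup_add power_add prod.distrib monom_eval_superset[of ?A])
  finally show ?thesis .
qed

lemma mpoly_eval_superset:
  assumes "finite A" "Poly_Mapping.keys f \<subseteq> A"
  shows "mpoly_eval f a = (\<Sum>m\<in>A. Poly_Mapping.lookup f m * monom_eval m a)"
  unfolding mpoly_eval_def monom_eval_def using assms
  by (intro sum.mono_neutral_left) (auto simp: in_keys_iff)

lemma mpoly_eval_single: "mpoly_eval (Poly_Mapping.single m c) a = c * monom_eval m a"
  by (simp add: mpoly_eval_superset[of "{m}"])

lemma mpoly_eval_0 [simp]: "mpoly_eval 0 a = 0"
  by (simp add: mpoly_eval_def)

lemma mpoly_eval_1 [simp]: "mpoly_eval 1 a = 1"
  by (simp add: mpoly_eval_single monom_eval_def flip: single_one)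

lemma mpoly_eval_add: "mpoly_eval (f + g) a = mpoly_eval f a + mpoly_eval g a"
proof -
  let ?A = "Poly_Mapping.keys f \<union> Poly_Mapping.keys g"
  have "mpoly_eval (f + g) a = (\<Sum>m\<in>?A. Poly_Mapping.lookup (f + g) m * monom_eval m a)"
    by (rule mpoly_eval_superset) (use Poly_Mapping.keys_add[of f g] in auto)
  also have "\<dots> = mpoly_eval f a + mpoly_eval g a"
    by (simp add: lookup_add distrib_right sum.distrib mpoly_eval_superset[of ?A])
  finally show ?thesis .
qed

lemma mpoly_eval_sum: "mpoly_eval (\<Sum>x\<in>A. f x) a = (\<Sum>x\<in>A. mpoly_eval (f x) a)"
  by (induction A rule: infinite_finite_induct) (auto simp: mpoly_eval_add)

lemma poly_mapping_sum_single:
  "f = (\<Sum>m\<in>Poly_Mapping.keys f. Poly_Mapping.single m (Poly_Mapping.lookup f m))"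
  by (rule poly_mapping_eqI)
    (auto simp: lookup_sum lookup_single when_def not_in_keys_iff_lookup_eq_zero)

text \<open>Expanding both polynomials into single terms and using additivity of evaluation leaves
  only \<open>monom_eval_add\<close>.\<close>

lemma mpoly_eval_mult: "mpoly_eval (f * g) a = mpoly_eval f a * mpoly_eval g a"
proof -
  have "f * g = (\<Sum>m\<in>Poly_Mapping.keys f. \<Sum>m'\<in>Poly_Mapping.keys g.
      Poly_Mapping.single (m + m') (Poly_Mapping.lookup f m * Poly_Mapping.lookup g m'))"
    by (subst poly_mapping_sum_single[of f], subst poly_mapping_sum_single[of g])
      (simp add: sum_product mult_single)
  then have "mpoly_eval (f * g) a = (\<Sum>m\<in>Poly_Mapping.keys f. \<Sum>m'\<in>Poly_Mapping.keys g.
      (Poly_Mapping.lookup f m * Poly_Mapping.lookup g m') * (monom_eval m a * monom_eval m' a))"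
    by (simp add: mpoly_eval_sum mpoly_eval_single monom_eval_add)
  also have "\<dots> = mpoly_eval f a * mpoly_eval g a"
    unfolding mpoly_eval_def monom_eval_def[symmetric] sum_product by (simp add: mult_ac)
  finally show ?thesis .
qed

lemma mpoly_eval_scale: "mpoly_eval (mpoly_scale c f) a = c * mpoly_eval f a"
  by (simp add: mpoly_scale_def mpoly_eval_mult mpoly_eval_single monom_eval_def)

lemma mpoly_eval_prod: "mpoly_eval (\<Prod>x\<in>A. f x) a = (\<Prod>x\<in>A. mpoly_eval (f x) a)"
  by (induction A rule: infinite_finite_induct) (auto simp: mpoly_eval_mult)

section \<open>Multihomogeneous polynomials\<close>

text \<open>The support condition is included because \<open>multidegree\<close> does not see
  variables outside the ring. Membership in the graded piece R_j then becomes a test on each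
  monomial separately.\<close>

definition has_multidegree :: "nat \<Rightarrow> (nat \<Rightarrow> nat) \<Rightarrow> (nat \<Rightarrow> nat) \<Rightarrow> monom \<Rightarrow> bool" where
  "has_multidegree k n j m \<longleftrightarrow> Poly_Mapping.keys m \<subseteq> (SIGMA i:{1..k}. {0..n i}) \<and>
     (\<forall>i\<in>{1..k}. multidegree n m i = j i)"

abbreviation forms :: "nat \<Rightarrow> (nat \<Rightarrow> nat) \<Rightarrow> (nat \<Rightarrow> nat) \<Rightarrow> 'a::field mpoly set" where
  "forms k n j \<equiv> graded_part k n (poly_ring k n) j"

lemma forms_iff: "f \<in> forms k n j \<longleftrightarrow> (\<forall>m\<in>Poly_Mapping.keys f. has_multidegree k n j m)"
  by (auto simp: graded_part_def poly_ring_def has_multidegree_def)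

lemma forms_cong: "(\<And>i. i \<in> {1..k} \<Longrightarrow> j i = j' i) \<Longrightarrow> forms k n j = forms k n j'"
  by (auto simp: graded_part_def)

lemma has_multidegree_add:
  assumes "has_multidegree k n j m" "has_multidegree k n j' m'"
  shows "has_multidegree k n (\<lambda>i. j i + j' i) (m + m')"
  using assms Poly_Mapping.keys_add[of m m']
  by (fastforce simp: has_multidegree_def multidegree_def lookup_add sum.distrib)

text \<open>Each exponent is at most some \<open>j i\<close>, hence at most their sum, and there are
  finitely many variables. This is what makes R_j finite-dimensional.\<close>

lemma finite_has_multidegree: "finite {m. has_multidegree k n j m}"
proof -
  let ?V = "SIGMA i:{1..k}. {0..n i}"
  let ?b = "\<Sum>i=1..k. j i"
  have "Poly_Mapping.lookup ` {m. has_multidegree k n j m} \<subseteq>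
      {f. \<forall>v. (v \<in> ?V \<longrightarrow> f v \<in> {..?b}) \<and> (v \<notin> ?V \<longrightarrow> f v = 0)}"
  proof
    fix f assume "f \<in> Poly_Mapping.lookup ` {m. has_multidegree k n j m}"
    then obtain m where f: "f = Poly_Mapping.lookup m" and m: "has_multidegree k n j m"
      by blast
    have "f v \<le> ?b" if vV: "v \<in> ?V" for v
    proof -
      obtain i h where v: "v = (i, h)" and "i \<in> {1..k}" "h \<in> {0..n i}"
        using vV by blast
      then have ih: "i \<in> {1..k}" "h \<le> n i" by auto
      have "f v \<le> multidegree n m i"
        unfolding multidegree_def f v using ih by (intro member_le_sum) auto
      also have "\<dots> = j i" using m ih by (simp add: has_multidegree_def)
      also have "\<dots> \<le> ?b" using ih by (intro member_le_sum) auto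
      finally show ?thesis .
    qed
    moreover have "f v = 0" if "v \<notin> ?V" for v
      using m that unfolding has_multidegree_def f by (meson in_keys_iff subsetD)
    ultimately show "f \<in> {f. \<forall>v. (v \<in> ?V \<longrightarrow> f v \<in> {..?b}) \<and> (v \<notin> ?V \<longrightarrow> f v = 0)}"
      by simp
  qed
  moreover have "finite \<dots>" by (rule finite_set_of_finite_funs) auto
  ultimately have "finite (Poly_Mapping.lookup ` {m. has_multidegree k n j m})"
    by (rule finite_subset)
  \<comment> \<open>\<open>lookup\<close> is injective, so finiteness passes from exponent functions
    back to monomials.\<close>
  then show ?thesis
    by (rule finite_imageD) (auto intro!: inj_onI poly_mapping_eqI)
qed

lemma forms_0: "0 \<in> forms k n j"
  by (simp add: forms_iff)

lemma forms_add: "f \<in> forms k n j \<Longrightarrow> g \<in> forms k n j \<Longrightarrow> f + g \<in> forms k n j"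
  unfolding forms_iff using Poly_Mapping.keys_add[of f g] by blast

lemma forms_sum: "(\<And>x. x \<in> A \<Longrightarrow> f x \<in> forms k n j) \<Longrightarrow> (\<Sum>x\<in>A. f x) \<in> forms k n j"
  by (induction A rule: infinite_finite_induct) (auto simp: forms_0 forms_add)

lemma forms_mult:
  assumes "f \<in> forms k n j" "g \<in> forms k n j'"
  shows "f * g \<in> forms k n (\<lambda>i. j i + j' i)"
  using assms Poly_Mapping.keys_mult[of f g] unfolding forms_iff
  by (blast intro: has_multidegree_add)

lemma forms_single: "has_multidegree k n j m \<Longrightarrow> Poly_Mapping.single m c \<in> forms k n j"
  by (simp add: forms_iff)

lemma forms_1: "1 \<in> forms k n (\<lambda>_. 0)"
  by (simp add: forms_iff has_multidegree_def multidegree_def)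

lemma forms_scale: "f \<in> forms k n j \<Longrightarrow> mpoly_scale c f \<in> forms k n j"
  using forms_mult[OF forms_single[of k n "\<lambda>_. 0" 0 c], of f j]
  by (simp add: mpoly_scale_def has_multidegree_def multidegree_def)

lemma forms_prod:
  "finite A \<Longrightarrow> (\<And>x. x \<in> A \<Longrightarrow> f x \<in> forms k n (d x)) \<Longrightarrow>
    (\<Prod>x\<in>A. f x) \<in> forms k n (\<lambda>i. \<Sum>x\<in>A. d x i)"
  by (induction A rule: finite_induct) (auto simp: forms_1 forms_mult)

text \<open>The monomials of degree \<open>j\<close> span R_j; they provide the finite spanning set
  for \<open>dim_diff_dim_kernel\<close>.\<close>

lemma forms_subset_span:
  "(forms k n j :: 'a::field mpoly set) \<subseteq>
    module.span mpoly_scale ((\<lambda>m. Poly_Mapping.single m 1) ` {m. has_multidegree k n j m})"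
proof
  interpret vector_space "mpoly_scale :: 'a \<Rightarrow> 'a mpoly \<Rightarrow> 'a mpoly"
    by (rule vector_space_mpoly_scale)
  fix f :: "'a mpoly" assume f: "f \<in> forms k n j"
  have "f = (\<Sum>m\<in>Poly_Mapping.keys f.
      mpoly_scale (Poly_Mapping.lookup f m) (Poly_Mapping.single m 1))"
    by (subst poly_mapping_sum_single) (simp add: mpoly_scale_def mult_single)
  also have "\<dots> \<in> span ((\<lambda>m. Poly_Mapping.single m 1) ` {m. has_multidegree k n j m})"
    using f unfolding forms_iff by (intro span_sum span_scale span_base) auto
  finally show "f \<in> span ((\<lambda>m. Poly_Mapping.single m 1) ` {m. has_multidegree k n j m})" .
qed

text \<open>Rescaling the \<open>i\<close>-th group of variables by \<open>c i\<close> pulls out one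
  factor \<open>c i\<close> per unit of degree in that group.\<close>

lemma monom_eval_proportional:
  assumes m: "has_multidegree k n j m"
    and c: "\<And>i h. i \<in> {1..k} \<Longrightarrow> b (i, h) = c i * a (i, h)"
  shows "monom_eval m b = (\<Prod>i\<in>{1..k}. c i ^ j i) * monom_eval m a"
proof -
  let ?V = "SIGMA i:{1..k}. {0..n i}"
  \<comment> \<open>The variables are grouped by the factor they belong to, so that each
    \<open>c i\<close> can be collected.\<close>
  have *: "monom_eval m x = (\<Prod>i\<in>{1..k}. \<Prod>h\<in>{0..n i}. x (i, h) ^ Poly_Mapping.lookup m (i, h))"
    for x :: "nat \<times> nat \<Rightarrow> 'a"
    using m by (subst monom_eval_superset[of ?V])
      (auto simp: has_multidegree_def prod.Sigma split_def)
  have "monom_eval m b = (\<Prod>i\<in>{1..k}. c i ^ multidegree n m i *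
      (\<Prod>h\<in>{0..n i}. a (i, h) ^ Poly_Mapping.lookup m (i, h)))"
    unfolding * by (intro prod.cong refl)
      (simp add: c power_mult_distrib prod.distrib multidegree_def power_sum atLeast0AtMost)
  also have "\<dots> = (\<Prod>i\<in>{1..k}. c i ^ j i) * monom_eval m a"
    using m by (simp add: * prod.distrib has_multidegree_def)
  finally show ?thesis .
qed

lemma mpoly_eval_proportional:
  assumes "f \<in> forms k n j" "\<And>i h. i \<in> {1..k} \<Longrightarrow> b (i, h) = c i * a (i, h)"
  shows "mpoly_eval f b = (\<Prod>i\<in>{1..k}. c i ^ j i) * mpoly_eval f a"
  using assms monom_eval_proportional[of k n j _ b c a]
  unfolding mpoly_eval_def monom_eval_def[symmetric] forms_iff
  by (simp add: sum_distrib_left sum_distrib_right mult_ac)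

section \<open>Separating and interpolating the points of one factor\<close>

text \<open>Fixes one coordinate vector per projective point, so that a form has a definite value
  there and not just one up to scaling.\<close>

definition coord :: "(nat \<Rightarrow> 'a::field) set \<Rightarrow> nat \<Rightarrow> 'a" where
  "coord p = (SOME v. v \<in> p)"

lemma coord_in: "p \<in> proj_space N \<Longrightarrow> coord p \<in> p"
  unfolding coord_def proj_space_def
  using in_quotient_imp_non_empty[OF equiv_proportional] by (metis ex_in_conv someI)

lemma coord_nonzero: "p \<in> proj_space N \<Longrightarrow> coord p \<in> nonzero_vecs N"
  using coord_in in_quotient_imp_subset[OF equiv_proportional] unfolding proj_space_def by blast

lemma proj_space_eqI:
  assumes "p \<in> proj_space N" "q \<in> proj_space N" "(coord p, coord q) \<in> proportional N"
  shows "p = q"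
  using quotient_eqI[OF equiv_proportional] assms coord_in unfolding proj_space_def by blast

lemma forms_variable:
  assumes "i \<in> {1..k}" "h \<le> n i"
  shows "Poly_Mapping.single (Poly_Mapping.single (i, h) 1) c \<in> forms k n (\<lambda>l. if l = i then 1 else 0)"
  using assms
  by (intro forms_single)
    (auto simp: has_multidegree_def multidegree_def lookup_single when_def sum.delta')

lemma mpoly_eval_variable:
  "mpoly_eval (Poly_Mapping.single (Poly_Mapping.single v 1) c) a = c * a v"
  by (simp add: mpoly_eval_single monom_eval_def)

text \<open>Only the \<open>i\<close>-th block of coordinates is prescribed. A form in the
  \<open>i\<close>-th group of variables built for the point \<open>p\<close> can thus be evaluated
  at every point of the product lying over \<open>p\<close>.\<close>

definition points_over :: "nat \<Rightarrow> (nat \<Rightarrow> 'a::field) set \<Rightarrow> (nat \<times> nat \<Rightarrow> 'a) set" where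
  "points_over i p = {a. \<forall>h. a (i, h) = coord p h}"

text \<open>Some coordinate of \<open>p\<close> is nonzero; the corresponding variable is divided by
  it. Such forms later raise the degree without changing the value at \<open>p\<close>.\<close>

lemma exists_nonvanishing_linear_form:
  assumes "i \<in> {1..k}" "p \<in> proj_space (n i)"
  shows "\<exists>L::'a::field mpoly. L \<in> forms k n (\<lambda>l. if l = i then 1 else 0) \<and>
    (\<forall>a\<in>points_over i p. mpoly_eval L a = 1)"
proof -
  obtain h where h: "h \<le> n i" "coord p h \<noteq> 0"
    using coord_nonzero[OF assms(2)] by (auto simp: nonzero_vecs_def)
  let ?L = "Poly_Mapping.single (Poly_Mapping.single (i, h) 1) (inverse (coord p h)) :: 'a mpoly"
  have "?L \<in> forms k n (\<lambda>l. if l = i then 1 else 0)"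
    by (rule forms_variable[where n = n, OF assms(1) h(1)])
  moreover have "mpoly_eval ?L a = 1" if "a \<in> points_over i p" for a
    unfolding mpoly_eval_variable using that h(2) by (simp add: points_over_def)
  ultimately show ?thesis by blast
qed

text \<open>With \<open>v\<close>, \<open>w\<close> the coordinates of \<open>p\<close>,
  \<open>q\<close>, the form \<open>w h * x g - w g * x h\<close> vanishes at \<open>q\<close>. Its
  value at \<open>p\<close> is a 2x2 minor of the two vectors, and if all minors with a suitable
  fixed \<open>h\<close> vanished, \<open>v\<close> and \<open>w\<close> would be
  proportional.\<close>

lemma exists_separating_linear_form:
  assumes i: "i \<in> {1..k}" and p: "p \<in> proj_space (n i)" and q: "q \<in> proj_space (n i)"
    and "p \<noteq> q"
  shows "\<exists>L::'a::field mpoly. L \<in> forms k n (\<lambda>l. if l = i then 1 else 0) \<and>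
    (\<forall>a\<in>points_over i p. mpoly_eval L a = 1) \<and> (\<forall>a\<in>points_over i q. mpoly_eval L a = 0)"
proof -
  let ?v = "coord p" and ?w = "coord q"
  note nz = coord_nonzero[OF p] coord_nonzero[OF q]
  obtain h where h: "h \<le> n i" "?w h \<noteq> 0"
    using nz by (auto simp: nonzero_vecs_def)
  have "\<exists>g\<le>n i. ?w h * ?v g - ?w g * ?v h \<noteq> 0"
  proof (rule ccontr)
    assume neg: "\<not> (\<exists>g\<le>n i. ?w h * ?v g - ?w g * ?v h \<noteq> 0)"
    \<comment> \<open>Beyond \<open>n i\<close> both vectors are zero, so the equation holds for all
      indices.\<close>
    have eq: "?w h * ?v g = ?w g * ?v h" for g
      using neg nz by (cases "g \<le> n i") (auto simp: nonzero_vecs_def)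
    have "?v h \<noteq> 0"
    proof
      assume "?v h = 0"
      then have "?v g = 0" for g using eq[of g] h by simp
      then show False using nz by (auto simp: nonzero_vecs_def)
    qed
    moreover from this have "?w = (\<lambda>g. (?w h / ?v h) * ?v g)"
      using eq by (auto simp: field_simps)
    ultimately have "(?v, ?w) \<in> proportional (n i)"
      using nz h unfolding proportional_def by (auto intro!: exI[of _ "?w h / ?v h"])
    then show False using proj_space_eqI[OF p q] \<open>p \<noteq> q\<close> by blast
  qed
  then obtain g where g: "g \<le> n i" "?w h * ?v g - ?w g * ?v h \<noteq> 0" by blast
  \<comment> \<open>The value of the unnormalized form at \<open>p\<close>; dividing by it makes the
    value 1.\<close>
  define e where "e = ?w h * ?v g - ?w g * ?v h"
  let ?x = "\<lambda>h c. Poly_Mapping.single (Poly_Mapping.single (i, h) 1) c :: 'a mpoly"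
  let ?L = "?x g (?w h / e) + ?x h (- (?w g / e))"
  have eval: "mpoly_eval ?L a = (?w h * a (i, g) - ?w g * a (i, h)) / e" for a
    unfolding mpoly_eval_add mpoly_eval_variable by (simp add: field_simps diff_divide_distrib)
  have "?L \<in> forms k n (\<lambda>l. if l = i then 1 else 0)"
    using g h i by (intro forms_add forms_variable) auto
  moreover have "mpoly_eval ?L a = 1" if "a \<in> points_over i p" for a
    unfolding eval using that g(2) by (simp add: points_over_def e_def)
  moreover have "mpoly_eval ?L a = 0" if "a \<in> points_over i q" for a
    unfolding eval using that by (simp add: points_over_def)
  ultimately show ?thesis by blast
qed

text \<open>Induction on the degree: each linear factor removes one point of \<open>B\<close>. Once
  \<open>B\<close> is exhausted, the remaining degree is filled with linear forms equal to 1 at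
  \<open>p\<close>.\<close>

lemma exists_separator:
  assumes i: "i \<in> {1..k}" and p: "p \<in> proj_space (n i)"
    and "finite B" "B \<subseteq> proj_space (n i)" "p \<notin> B" "card B \<le> d"
  shows "\<exists>f::'a::field mpoly. f \<in> forms k n (\<lambda>l. if l = i then d else 0) \<and>
    (\<forall>a\<in>points_over i p. mpoly_eval f a = 1) \<and>
    (\<forall>q\<in>B. \<forall>a\<in>points_over i q. mpoly_eval f a = 0)"
  using assms(3-6)
proof (induction d arbitrary: B)
  case 0
  then show ?case by (intro exI[of _ 1]) (simp add: forms_1)
next
  case (Suc d)
  have deg: "(\<lambda>l. (if l = i then 1 else 0) + (if l = i then d else 0)) =
      (\<lambda>l. if l = i then Suc d else 0)" by auto
  \<comment> \<open>\<open>C\<close> collects the points left to the induction hypothesis: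
    \<open>B\<close> without the point killed by \<open>L\<close>, or the empty set if
    \<open>B\<close> is already empty.\<close>
  obtain C L where C: "finite C" "C \<subseteq> proj_space (n i)" "p \<notin> C" "card C \<le> d"
    and L: "L \<in> forms k n (\<lambda>l. if l = i then 1 else 0)"
      "\<forall>a\<in>points_over i p. mpoly_eval L a = (1::'a)"
    and BC: "\<forall>q\<in>B - C. \<forall>a\<in>points_over i q. mpoly_eval L a = 0"
  proof (cases "B = {}")
    case True
    then show thesis
      using exists_nonvanishing_linear_form[where n = n, OF i p] that[of "{}"] by auto
  next
    case False
    then obtain q where q: "q \<in> B" by blast
    then have q': "q \<in> proj_space (n i)" "p \<noteq> q" using Suc.prems by auto
    from exists_separating_linear_form[where n = n, OF i p q']
    obtain L :: "'a mpoly" where L: "L \<in> forms k n (\<lambda>l. if l = i then 1 else 0)"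
      "\<forall>a\<in>points_over i p. mpoly_eval L a = 1" "\<forall>a\<in>points_over i q. mpoly_eval L a = 0"
      by blast
    show thesis
      using Suc.prems q L by (intro that[of "B - {q}" L]) auto
  qed
  from Suc.IH[OF C] obtain f :: "'a mpoly" where
    f: "f \<in> forms k n (\<lambda>l. if l = i then d else 0)" "\<forall>a\<in>points_over i p. mpoly_eval f a = 1"
      "\<forall>q\<in>C. \<forall>a\<in>points_over i q. mpoly_eval f a = 0"
    by blast
  have "L * f \<in> forms k n (\<lambda>l. if l = i then Suc d else 0)"
    using forms_mult[OF L(1) f(1)] unfolding deg .
  moreover have "\<forall>a\<in>points_over i p. mpoly_eval (L * f) a = 1"
    using L(2) f(2) by (simp add: mpoly_eval_mult)
  moreover have "\<forall>q\<in>B. \<forall>a\<in>points_over i q. mpoly_eval (L * f) a = 0"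
  proof (intro ballI)
    fix q a assume "q \<in> B" "a \<in> points_over i q"
    then have "mpoly_eval L a = 0 \<or> mpoly_eval f a = 0"
      using BC f(3) by blast
    then show "mpoly_eval (L * f) a = 0" by (simp add: mpoly_eval_mult)
  qed
  ultimately show ?case by blast
qed

text \<open>The points to be killed are those of \<open>A - {p}\<close>. There are
  \<open>card A - 1\<close> of them, which is the origin of the bound
  \<open>t i - 1\<close>.\<close>

lemma exists_separator_in_finite_set:
  assumes i: "i \<in> {1..k}" and A: "finite A" "A \<subseteq> proj_space (n i)" "card A - 1 \<le> d"
    and p: "p \<in> A"
  shows "\<exists>f::'a::field mpoly. f \<in> forms k n (\<lambda>l. if l = i then d else 0) \<and>
    (\<forall>q\<in>A. \<forall>a\<in>points_over i q. mpoly_eval f a = (if q = p then 1 else 0))"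
proof -
  have "\<exists>f::'a mpoly. f \<in> forms k n (\<lambda>l. if l = i then d else 0) \<and>
    (\<forall>a\<in>points_over i p. mpoly_eval f a = 1) \<and>
    (\<forall>q\<in>A - {p}. \<forall>a\<in>points_over i q. mpoly_eval f a = 0)"
    using A p by (intro exists_separator[OF i]) auto
  then show ?thesis by (elim ex_forward) auto
qed

text \<open>Lagrange interpolation: the separators of the points of \<open>A\<close>, weighted by
  the prescribed values, are added up.\<close>

lemma exists_interpolant:
  fixes \<phi> :: "(nat \<Rightarrow> 'a::field) set \<Rightarrow> 'a"
  assumes i: "i \<in> {1..k}" and A: "finite A" "A \<subseteq> proj_space (n i)" "card A - 1 \<le> d"
  shows "\<exists>f::'a mpoly. f \<in> forms k n (\<lambda>l. if l = i then d else 0) \<and>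
    (\<forall>q\<in>A. \<forall>a\<in>points_over i q. mpoly_eval f a = \<phi> q)"
proof -
  have "\<forall>p\<in>A. \<exists>f::'a mpoly. f \<in> forms k n (\<lambda>l. if l = i then d else 0) \<and>
    (\<forall>q\<in>A. \<forall>a\<in>points_over i q. mpoly_eval f a = (if q = p then 1 else 0))"
    by (intro ballI exists_separator_in_finite_set i A)
  from bchoice[OF this] obtain S :: "_ \<Rightarrow> 'a mpoly" where
    S: "\<forall>p\<in>A. S p \<in> forms k n (\<lambda>l. if l = i then d else 0) \<and>
    (\<forall>q\<in>A. \<forall>a\<in>points_over i q. mpoly_eval (S p) a = (if q = p then 1 else 0))"
    by (rule exE)
  let ?f = "\<Sum>p\<in>A. mpoly_scale (\<phi> p) (S p)"
  have "?f \<in> forms k n (\<lambda>l. if l = i then d else 0)"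
    using S by (intro forms_sum forms_scale) blast
  moreover have "mpoly_eval ?f a = \<phi> q" if q: "q \<in> A" "a \<in> points_over i q" for q a
  proof -
    have "mpoly_eval ?f a = (\<Sum>p\<in>A. \<phi> p * (if q = p then 1 else 0))"
      unfolding mpoly_eval_sum mpoly_eval_scale using S q by (intro sum.cong) auto
    also have "\<dots> = \<phi> q" using q A(1) by (simp add: if_distrib sum.delta cong: if_cong)
    finally show ?thesis .
  qed
  ultimately show ?thesis by blast
qed

section \<open>The Hilbert function as a rank\<close>

definition rep :: "(nat \<Rightarrow> (nat \<Rightarrow> 'a::field) set) \<Rightarrow> nat \<times> nat \<Rightarrow> 'a" where
  "rep P = (\<lambda>(i, h). coord (P i) h)"

lemma rep_in_points_over: "rep P \<in> points_over i (P i)"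
  by (simp add: points_over_def rep_def)

lemma multiproj_space_in: "P \<in> multiproj_space k n \<Longrightarrow> i \<in> {1..k} \<Longrightarrow> P i \<in> proj_space (n i)"
  by (auto simp: multiproj_space_def)

lemma represents_rep: "P \<in> multiproj_space k n \<Longrightarrow> represents k (rep P) P"
  using coord_in multiproj_space_in by (fastforce simp: represents_def rep_def)

text \<open>Any two choices of coordinates of \<open>P\<close> are proportional in each block, and a
  form changes only by a scalar factor between them. Vanishing at the chosen \<open>rep P\<close>
  therefore decides vanishing at \<open>P\<close>.\<close>

lemma vanishes_iff_vanishes_at_rep:
  assumes P: "P \<in> multiproj_space k n" and f: "f \<in> forms k n j"
  shows "(\<forall>a. represents k a P \<longrightarrow> mpoly_eval f a = 0) \<longleftrightarrow> mpoly_eval f (rep P) = 0"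
proof
  assume "\<forall>a. represents k a P \<longrightarrow> mpoly_eval f a = 0"
  then show "mpoly_eval f (rep P) = 0" using represents_rep[OF P] by blast
next
  assume z: "mpoly_eval f (rep P) = 0"
  show "\<forall>a. represents k a P \<longrightarrow> mpoly_eval f a = 0"
  proof (intro allI impI)
    fix a :: "nat \<times> nat \<Rightarrow> 'a" assume a: "represents k a P"
    have "\<forall>i\<in>{1..k}. \<exists>c. \<forall>h. a (i, h) = c * rep P (i, h)"
    proof
      fix i assume i: "i \<in> {1..k}"
      have "P i \<in> proj_space (n i)" by (rule multiproj_space_in[OF P i])
      moreover have "coord (P i) \<in> P i" by (rule coord_in) fact
      moreover have "(\<lambda>h. a (i, h)) \<in> P i" using a i by (auto simp: represents_def)
      ultimately have "(coord (P i), \<lambda>h. a (i, h)) \<in> proportional (n i)"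
        unfolding proj_space_def by (intro in_quotient_imp_in_rel[OF equiv_proportional]) auto
      then obtain c where "(\<lambda>h. a (i, h)) = (\<lambda>h. c * coord (P i) h)"
        by (auto simp: proportional_def)
      then show "\<exists>c. \<forall>h. a (i, h) = c * rep P (i, h)"
        by (auto simp: rep_def fun_eq_iff)
    qed
    then obtain c where "\<And>i h. i \<in> {1..k} \<Longrightarrow> a (i, h) = c i * rep P (i, h)" by metis
    from mpoly_eval_proportional[of f k n j a c "rep P", OF f this] show "mpoly_eval f a = 0" using z by simp
  qed
qed

definition fun_scale :: "'a::field \<Rightarrow> ('b \<Rightarrow> 'a) \<Rightarrow> 'b \<Rightarrow> 'a" where
  "fun_scale c g = (\<lambda>x. c * g x)"

lemma vector_space_fun_scale: "vector_space (fun_scale :: 'a::field \<Rightarrow> ('b \<Rightarrow> 'a) \<Rightarrow> 'b \<Rightarrow> 'a)"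
  by unfold_locales (auto simp: fun_scale_def algebra_simps)

text \<open>The evaluation map from forms to functions on \<open>X\<close>. The default 0 outside
  \<open>X\<close> embeds these functions in a full function type, where they form a
  subspace.\<close>

definition eval_on :: "(nat \<Rightarrow> (nat \<Rightarrow> 'a::field) set) set \<Rightarrow> 'a mpoly \<Rightarrow>
    (nat \<Rightarrow> (nat \<Rightarrow> 'a) set) \<Rightarrow> 'a" where
  "eval_on X f = (\<lambda>P. if P \<in> X then mpoly_eval f (rep P) else 0)"

text \<open>The part of degree \<open>j\<close> of the vanishing ideal is the kernel of evaluation
  on R_j, so rank-nullity turns the difference of dimensions into the dimension of the
  image.\<close>

lemma hilbert_function_eq_dim_eval_on:
  fixes X :: "(nat \<Rightarrow> (nat \<Rightarrow> 'a::field) set) set"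
  assumes "X \<subseteq> multiproj_space k n"
  shows "hilbert_function k n X j = vector_space.dim fun_scale (eval_on X ` forms k n j)"
proof -
  interpret p: vector_space_pair "mpoly_scale :: 'a \<Rightarrow> 'a mpoly \<Rightarrow> 'a mpoly"
    "fun_scale :: 'a \<Rightarrow> ((nat \<Rightarrow> (nat \<Rightarrow> 'a) set) \<Rightarrow> 'a) \<Rightarrow> _"
    by (intro vector_space_pair.intro vector_space_mpoly_scale vector_space_fun_scale)
  have lin: "Vector_Spaces.linear mpoly_scale fun_scale (eval_on X)"
    by unfold_locales
      (auto simp: eval_on_def fun_scale_def mpoly_eval_add mpoly_eval_scale fun_eq_iff)
  have sub: "p.vs1.subspace (forms k n j)"
    by (auto simp: p.vs1.subspace_def forms_0 forms_add forms_scale)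
  have ker: "graded_part k n (vanishing_ideal k n X) j = {f \<in> forms k n j. eval_on X f = 0}"
    (is "?I = ?K")
  proof (rule set_eqI)
    fix f :: "'a mpoly"
    have "f \<in> ?I \<longleftrightarrow> f \<in> forms k n j \<and>
        (\<forall>P\<in>X. \<forall>a. represents k a P \<longrightarrow> mpoly_eval f a = 0)"
      by (auto simp: graded_part_def vanishing_ideal_def)
    also have "\<dots> \<longleftrightarrow> f \<in> forms k n j \<and> (\<forall>P\<in>X. mpoly_eval f (rep P) = 0)"
      using vanishes_iff_vanishes_at_rep[of _ k n f j] assms by blast
    also have "\<dots> \<longleftrightarrow> f \<in> ?K" by (auto simp: eval_on_def fun_eq_iff)
    finally show "f \<in> ?I \<longleftrightarrow> f \<in> ?K" .
  qed
  show ?thesis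
    unfolding hilbert_function_def ker
    by (rule p.dim_diff_dim_kernel[OF lin sub _ forms_subset_span])
      (simp add: finite_has_multidegree)
qed

text \<open>The indicator functions \<open>e x\<close> of the points of \<open>X\<close> form a
  basis; coefficients are read off by evaluating at each point.\<close>

lemma dim_functions_supported_on:
  assumes "finite X"
  shows "vector_space.dim fun_scale {g :: 'b \<Rightarrow> 'a::field. \<forall>x. x \<notin> X \<longrightarrow> g x = 0} = card X"
proof -
  interpret vector_space "fun_scale :: 'a \<Rightarrow> ('b \<Rightarrow> 'a) \<Rightarrow> 'b \<Rightarrow> 'a"
    by (rule vector_space_fun_scale)
  let ?S = "{g :: 'b \<Rightarrow> 'a. \<forall>x. x \<notin> X \<longrightarrow> g x = 0}"
  define e :: "'b \<Rightarrow> 'b \<Rightarrow> 'a" where "e x y = (if x = y then 1 else 0)" for x y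
  have inj: "inj e"
    by (rule injI) (metis e_def zero_neq_one)
  have sum_e: "(\<Sum>x\<in>Y. fun_scale (c x) (e x)) = (\<lambda>y. if y \<in> Y then c y else 0)"
    if "finite Y" for Y c
    using that by (induction Y rule: finite_induct) (auto simp: fun_scale_def e_def fun_eq_iff)
  have ind: "independent (e ` X)"
  proof (rule independent_if_scalars_zero)
    fix f g assume z: "(\<Sum>x\<in>e ` X. fun_scale (f x) x) = 0" and g: "g \<in> e ` X"
    then have "(\<Sum>x\<in>X. fun_scale (f (e x)) (e x)) = 0"
      using inj by (subst (asm) sum.reindex) (auto intro: inj_on_subset)
    then have eq: "(\<lambda>y. if y \<in> X then f (e y) else 0) = 0"
      using sum_e[OF assms, of "\<lambda>x. f (e x)"] by simp
    have "f (e x) = 0" if "x \<in> X" for x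
      using fun_cong[OF eq, of x] that by simp
    then show "f g = 0" using g by blast
  qed (use assms in auto)
  have "?S \<subseteq> span (e ` X)"
  proof
    fix g assume "g \<in> ?S"
    then have "g = (\<Sum>x\<in>X. fun_scale (g x) (e x))" using sum_e[OF assms, of g] by auto
    also have "\<dots> \<in> span (e ` X)" by (intro span_sum span_scale span_base) auto
    finally show "g \<in> span (e ` X)" .
  qed
  moreover have "e ` X \<subseteq> ?S" by (auto simp: e_def)
  ultimately have "dim ?S = card (e ` X)" using ind basis_card_eq_dim[of "e ` X" ?S] by simp
  then show ?thesis using inj by (simp add: card_image inj_on_subset)
qed

section \<open>Surjectivity of evaluation in large degrees\<close>

lemma factor_proj_subset_proj_space:
  assumes "X \<subseteq> multiproj_space k n" "i \<in> {1..k}"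
  shows "factor_proj i ` X \<subseteq> proj_space (n i)"
  using assms multiproj_space_in by (fastforce simp: factor_proj_def)

text \<open>For each \<open>P\<close> in \<open>X\<close>, the product over \<open>i\<close> of
  forms separating \<open>P i\<close> from the other points of the \<open>i\<close>-th projection is
  1 at \<open>P\<close> and 0 on the rest of \<open>X\<close>. Combinations of these products reach
  every function on \<open>X\<close>.\<close>

lemma eval_on_forms_eq_supported_on:
  fixes X :: "(nat \<Rightarrow> (nat \<Rightarrow> 'a::field) set) set"
  assumes X: "X \<subseteq> multiproj_space k n" "finite X"
    and j: "\<And>i. i \<in> {1..k} \<Longrightarrow> card (factor_proj i ` X) - 1 \<le> j i"
  shows "eval_on X ` forms k n j = {g. \<forall>P. P \<notin> X \<longrightarrow> g P = 0}"
proof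
  show "eval_on X ` forms k n j \<subseteq> {g. \<forall>P. P \<notin> X \<longrightarrow> g P = 0}"
    by (auto simp: eval_on_def)
  have "\<exists>f::'a mpoly. f \<in> forms k n j \<and>
      (\<forall>Q\<in>X. mpoly_eval f (rep Q) = (if Q = P then 1 else 0))" if P: "P \<in> X" for P
  proof -
    have "\<forall>i\<in>{1..k}. \<exists>f::'a mpoly. f \<in> forms k n (\<lambda>l. if l = i then j i else 0) \<and>
      (\<forall>Q\<in>X. mpoly_eval f (rep Q) = (if Q i = P i then 1 else 0))"
    proof
      fix i assume i: "i \<in> {1..k}"
      have fin: "finite (factor_proj i ` X)" using X(2) by simp
      have Pi: "factor_proj i P \<in> factor_proj i ` X" using P by simp
      from exists_separator_in_finite_set[where n = n, OF i fin
          factor_proj_subset_proj_space[OF X(1) i] j[OF i] Pi]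
      obtain f :: "'a mpoly" where f: "f \<in> forms k n (\<lambda>l. if l = i then j i else 0)"
        "\<forall>q\<in>factor_proj i ` X. \<forall>a\<in>points_over i q.
          mpoly_eval f a = (if q = factor_proj i P then 1 else 0)"
        by blast
      have "mpoly_eval f (rep Q) = (if Q i = P i then 1 else 0)" if "Q \<in> X" for Q
        using f(2) rep_in_points_over[of Q i] that by (auto simp: factor_proj_def)
      with f(1)
      show "\<exists>f::'a mpoly. f \<in> forms k n (\<lambda>l. if l = i then j i else 0) \<and>
        (\<forall>Q\<in>X. mpoly_eval f (rep Q) = (if Q i = P i then 1 else 0))"
        by blast
    qed
    then obtain F :: "nat \<Rightarrow> 'a mpoly" where F:
      "\<And>i. i \<in> {1..k} \<Longrightarrow> F i \<in> forms k n (\<lambda>l. if l = i then j i else 0)"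
      "\<And>i Q. i \<in> {1..k} \<Longrightarrow> Q \<in> X \<Longrightarrow> mpoly_eval (F i) (rep Q) = (if Q i = P i then 1 else 0)"
      by metis
    \<comment> \<open>\<open>F i\<close> has degree \<open>j i\<close> in group \<open>i\<close> and
      0 in the others, so the degrees add up to \<open>j\<close> on \<open>{1..k}\<close>.\<close>
    have "(\<Prod>i\<in>{1..k}. F i) \<in> forms k n (\<lambda>l. \<Sum>i\<in>{1..k}. if l = i then j i else 0)"
      using F(1) by (intro forms_prod) auto
    also have "\<dots> = forms k n j" by (rule forms_cong) (simp add: sum.delta)
    finally have "(\<Prod>i\<in>{1..k}. F i) \<in> forms k n j" .
    moreover have "mpoly_eval (\<Prod>i\<in>{1..k}. F i) (rep Q) = (if Q = P then 1 else 0)" if Q: "Q \<in> X" for Q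
    proof (cases "Q = P")
      case True
      then show ?thesis using F(2) Q by (simp add: mpoly_eval_prod)
    next
      case False
      moreover have "Q \<in> multiproj_space k n" "P \<in> multiproj_space k n" using P Q X by auto
      \<comment> \<open>Points are extensional functions on \<open>{1..k}\<close>, so distinct
        points differ in some factor, and there the separator vanishes at \<open>Q\<close>.\<close>
      ultimately obtain i where "i \<in> {1..k}" "Q i \<noteq> P i"
        unfolding multiproj_space_def by (metis PiE_ext)
      then have "\<exists>i\<in>{1..k}. mpoly_eval (F i) (rep Q) = 0" using F(2) Q by auto
      then show ?thesis using False by (simp add: mpoly_eval_prod prod_zero)
    qed
    ultimately show ?thesis by blast
  qed
  then obtain F :: "_ \<Rightarrow> 'a mpoly" where F: "\<And>P. P \<in> X \<Longrightarrow> F P \<in> forms k n j"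
    "\<And>P Q. P \<in> X \<Longrightarrow> Q \<in> X \<Longrightarrow> mpoly_eval (F P) (rep Q) = (if Q = P then 1 else 0)"
    by metis
  show "{g. \<forall>P. P \<notin> X \<longrightarrow> g P = 0} \<subseteq> eval_on X ` forms k n j"
  proof
    fix g :: "(nat \<Rightarrow> (nat \<Rightarrow> 'a) set) \<Rightarrow> 'a" assume g: "g \<in> {g. \<forall>P. P \<notin> X \<longrightarrow> g P = 0}"
    define f where "f = (\<Sum>P\<in>X. mpoly_scale (g P) (F P))"
    have "f \<in> forms k n j" unfolding f_def using F(1) by (intro forms_sum forms_scale)
    moreover have "mpoly_eval f (rep Q) = g Q" if "Q \<in> X" for Q
    proof -
      have "mpoly_eval f (rep Q) = (\<Sum>P\<in>X. g P * (if Q = P then 1 else 0))"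
        unfolding f_def mpoly_eval_sum mpoly_eval_scale using F(2) that by (intro sum.cong) auto
      also have "\<dots> = g Q" using that X(2) by (simp add: if_distrib sum.delta cong: if_cong)
      finally show ?thesis .
    qed
    then have "eval_on X f = g" using g by (auto simp: eval_on_def fun_eq_iff)
    ultimately show "g \<in> eval_on X ` forms k n j" by blast
  qed
qed

section \<open>Changing the degree in one factor\<close>

lemma exists_restrict_monom:
  obtains m' :: monom
  where "\<And>v. Poly_Mapping.lookup m' v = (if Q v then Poly_Mapping.lookup m v else 0)"
proof
  have "finite {v. (if Q v then Poly_Mapping.lookup m v else 0) \<noteq> 0}"
    by (rule finite_subset[OF _ finite_keys[of m]]) (auto simp: in_keys_iff)
  then show "Poly_Mapping.lookup (Abs_poly_mapping (\<lambda>v. if Q v then Poly_Mapping.lookup m v else 0)) v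
      = (if Q v then Poly_Mapping.lookup m v else 0)" for v
    by (subst lookup_Abs_poly_mapping) auto
qed

text \<open>On \<open>X\<close>, the factor of a monomial in the \<open>i\<close>-th group of variables depends only on the
  \<open>i\<close>-th projection, so it can be replaced by an interpolating form of any degree \<open>\<ge> t\<^sub>i - 1\<close>.\<close>

lemma eval_on_forms_change_degree:
  fixes X :: "(nat \<Rightarrow> (nat \<Rightarrow> 'a::field) set) set"
  assumes X: "X \<subseteq> multiproj_space k n" "finite X" and i: "i \<in> {1..k}"
    and d: "card (factor_proj i ` X) - 1 \<le> d"
  shows "eval_on X ` forms k n j \<subseteq> eval_on X ` forms k n (j(i := d))"
proof
  have key: "\<exists>g::'a mpoly. g \<in> forms k n (j(i := d)) \<and>
      (\<forall>P\<in>X. mpoly_eval g (rep P) = monom_eval m (rep P))" if m: "has_multidegree k n j m" for m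
  proof -
    \<comment> \<open>\<open>m1\<close> is the part of \<open>m\<close> in the \<open>i\<close>-th
      group of variables, \<open>m2\<close> the part in all other groups. Only \<open>m1\<close>
      will be replaced.\<close>
    obtain m1 :: monom where
      m1: "\<And>v. Poly_Mapping.lookup m1 v = (if fst v = i then Poly_Mapping.lookup m v else 0)"
      using exists_restrict_monom[of "\<lambda>v. fst v = i" m] by blast
    obtain m2 :: monom where
      m2: "\<And>v. Poly_Mapping.lookup m2 v = (if fst v \<noteq> i then Poly_Mapping.lookup m v else 0)"
      using exists_restrict_monom[of "\<lambda>v. fst v \<noteq> i" m] by blast
    have split: "m = m1 + m2" by (rule poly_mapping_eqI) (simp add: lookup_add m1 m2)
    have "has_multidegree k n (j(i := 0)) m2"
      using m by (auto simp: has_multidegree_def multidegree_def m2 in_keys_iff subset_iff)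
    then have N: "Poly_Mapping.single m2 1 \<in> forms k n (j(i := 0))" by (rule forms_single)
    \<comment> \<open>The value of \<open>m1\<close> over the point \<open>q\<close> of the
      \<open>i\<close>-th factor. Since \<open>m1\<close> involves only variables of group
      \<open>i\<close>, using \<open>coord q\<close> for every group is harmless.\<close>
    define \<phi> where "\<phi> q = monom_eval m1 (\<lambda>(l, h). coord q h)" for q :: "(nat \<Rightarrow> 'a) set"
    have fin: "finite (factor_proj i ` X)" using X(2) by simp
    from exists_interpolant[where n = n, OF i fin factor_proj_subset_proj_space[OF X(1) i] d]
    obtain f :: "'a mpoly" where f: "f \<in> forms k n (\<lambda>l. if l = i then d else 0)"
      "\<forall>q\<in>factor_proj i ` X. \<forall>a\<in>points_over i q. mpoly_eval f a = \<phi> q"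
      by blast
    have "(\<lambda>l. (if l = i then d else 0) + (j(i := 0)) l) = j(i := d)" by auto
    with forms_mult[OF f(1) N]
    have "f * Poly_Mapping.single m2 1 \<in> forms k n (j(i := d))" by simp
    moreover have "mpoly_eval (f * Poly_Mapping.single m2 1) (rep P) = monom_eval m (rep P)"
      if P: "P \<in> X" for P
    proof -
      have "mpoly_eval f (rep P) = \<phi> (factor_proj i P)"
        using P f(2) rep_in_points_over[of P i] by (auto simp: factor_proj_def)
      also have "\<dots> = monom_eval m1 (rep P)"
        unfolding \<phi>_def monom_eval_def
        by (intro prod.cong) (auto simp: in_keys_iff m1 rep_def factor_proj_def split: if_splits)
      finally show ?thesis
        by (simp add: split mpoly_eval_mult mpoly_eval_single monom_eval_add)
    qed
    ultimately show ?thesis by blast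
  qed
  then obtain G :: "monom \<Rightarrow> 'a mpoly" where G:
    "\<And>m. has_multidegree k n j m \<Longrightarrow> G m \<in> forms k n (j(i := d))"
    "\<And>m P. has_multidegree k n j m \<Longrightarrow> P \<in> X \<Longrightarrow>
      mpoly_eval (G m) (rep P) = monom_eval m (rep P)"
    by metis
  fix y assume "y \<in> eval_on X ` forms k n j"
  then obtain f where f: "f \<in> forms k n j" "y = eval_on X f" by blast
  \<comment> \<open>The replacement of monomials is extended linearly to \<open>f\<close>, keeping
    all values on \<open>X\<close>.\<close>
  define g where "g = (\<Sum>m\<in>Poly_Mapping.keys f. mpoly_scale (Poly_Mapping.lookup f m) (G m))"
  have "g \<in> forms k n (j(i := d))"
    unfolding g_def using G(1) f(1) by (intro forms_sum forms_scale) (auto simp: forms_iff)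
  moreover have "mpoly_eval g (rep P) = mpoly_eval f (rep P)" if "P \<in> X" for P
    unfolding g_def mpoly_eval_sum mpoly_eval_scale
    unfolding mpoly_eval_def[of f] monom_eval_def[symmetric]
    using G(2) f(1) that by (intro sum.cong) (auto simp: forms_iff)
  then have "eval_on X g = y" using f(2) by (auto simp: eval_on_def)
  ultimately show "y \<in> eval_on X ` forms k n (j(i := d))" by blast
qed

theorem corollary4p8:
  fixes k s :: nat and n t :: "nat \<Rightarrow> nat"
    and X :: "(nat \<Rightarrow> (nat \<Rightarrow> 'a::{alg_closed_field, field_char_0}) set) set"
  assumes "k \<ge> 1"
    and "X \<subseteq> multiproj_space k n"
    and "finite X" and "X \<noteq> {}" and "card X = s"
    and "\<And>i. i \<in> {1..k} \<Longrightarrow> t i = card (factor_proj i ` X)"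
  shows "(\<forall>j. tuple_ge {1..k} j (\<lambda>h. t h - 1) \<longrightarrow> hilbert_function k n X j = s) \<and>
    (\<forall>j. \<forall>i\<in>{1..k}. j i \<ge> t i - 1 \<and> \<not> tuple_ge ({1..k} - {i}) j (\<lambda>h. t h - 1) \<longrightarrow>
      hilbert_function k n X j = hilbert_function k n X (j(i := t i - 1)))"
proof (intro conjI allI ballI impI)
  fix j assume "tuple_ge {1..k} j (\<lambda>h. t h - 1)"
  then have "card (factor_proj i ` X) - 1 \<le> j i" if "i \<in> {1..k}" for i
    using that assms(6) by (auto simp: tuple_ge_def)
  then show "hilbert_function k n X j = s"
    using assms eval_on_forms_eq_supported_on[of X k n j] dim_functions_supported_on[of X]
    by (simp add: hilbert_function_eq_dim_eval_on)
next
  fix j i assume i: "i \<in> {1..k}"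
    and "j i \<ge> t i - 1 \<and> \<not> tuple_ge ({1..k} - {i}) j (\<lambda>h. t h - 1)"
  then have ji: "card (factor_proj i ` X) - 1 \<le> j i" using assms(6) by auto
  \<comment> \<open>The degree in factor \<open>i\<close> is first changed from \<open>j i\<close>
    to \<open>t i - 1\<close> and then back. Both are at least \<open>t i - 1\<close>, so the two
    images contain each other.\<close>
  have "eval_on X ` forms k n j = eval_on X ` forms k n (j(i := t i - 1))"
    using eval_on_forms_change_degree[OF assms(2,3) i, of "t i - 1" j]
      eval_on_forms_change_degree[OF assms(2,3) i ji, of "j(i := t i - 1)"] assms(6)[OF i]
    by auto
  then show "hilbert_function k n X j = hilbert_function k n X (j(i := t i - 1))"
    using assms(2) by (simp add: hilbert_function_eq_dim_eval_on)
qed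

end
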